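(* Let $f$, $V$, $\pi:\hat X\to X$, $\Gamma$, $m$, $N$, $\beta_i$ and $s_e$ be as defined in the context. For $e$ outside a finite set, put $$P_e(s_e) = \sum_{i \leq N}\beta_i(e)\, s_e^i,$$ the truncation of $\hat Q_e(s_e)=\sum_{i\ge 0}\beta_i(e)s_e^i$ at index $N$, and consider the curve $$\hat{C}_e(s_e): s_e \mapsto [X_1 = 1 : X_2 = P_e(s_e) : T = s_e^m] .$$ Then $f(\hat{C}_e(s_e)) \rightarrow f(e) \in V$ as $s_e \rightarrow 0$.
   Context: Work over $\mathbf{C}$. $f:X_0=\mathbf{A}^2\to Y_0=\mathbf{A}^2$ is a Keller map (polynomial map with Jacobian determinant identically $1$). $V_f\subset Y_0$ is the set of points over which $f$ is not proper, and $V$ is an irreducible (codimension one) component of $V_f$. $X=\mathbf{P}^2\supset X_0$ has homogeneous coordinates $[X_1:X_2:T]$, with $x_i=X_i/T$; $Y=\mathbf{P}^2\supset Y_0$. $\pi:\hat X=X_n\to X_{n-1}\to\dots\to X_1=X$ is a sequence of blowups at closed points lying over the line at infinity $T=0$, and $\Gamma\subset\hat X$ is the last exceptional curve. It is chosen so that $f$ extends to a rational map $\hat X\to Y$ that is defined almost everywhere on $\Gamma$ and maps $\Gamma$ densely onto $V$. It is assumed that the first blown-up point is of the form $[1:\alpha_1:0]$. On the last affine chart $U_n=\mathrm{Spec}\,\mathbf{C}[g_{n-1},t_{n-1}]$ the curve $\Gamma$ is $\{g_{n-1}=0\}$, and $t_{n-1}=e$ is a coordinate on $\Gamma$; the point of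 $\Gamma$ with coordinate $e$ is also denoted $e$, and $f(e)\in V$ is its image. The curve $t\mapsto (g_{n-1}=t,\,t_{n-1}=e)$ has image $[X_1=1:X_2=Q_e(t):T=Z_e(t)]$ in $X$, with $Q_e(t),Z_e(t)$ polynomials in $e$ and $t$. Let $m\ge 1$ be the $t$-order of $Z_e(t)$ for all but finitely many $e$. For such $e$, let $s_e$ be a local parameter at $t=0$ with $s_e^m=Z_e(t)$. Expressing $Q_e(t)$ in terms of $s_e$ gives a convergent power series $\hat Q_e(s_e)=\sum_{i\ge 0}\beta_i(e)s_e^i$. $N$ is the first index $i$ for which $\beta_i(e)$ is not constant in $e$. *)

theory Defs
  imports
    "HOL-Analysis.Analysis"
    "HOL-Computational_Algebra.Computational_Algebra"
begin

text \<open>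
  An element of \<open>complex poly poly\<close> is a polynomial in two variables: the outer indeterminate
  is the first variable, the inner indeterminate is the second one.
\<close>

type_synonym bipoly = "complex poly poly"

definition const2 :: "complex \<Rightarrow> bipoly" where
  "const2 c = [:[:c:]:]"

definition var1 :: bipoly where
  "var1 = [:0, 1:]"

definition var2 :: bipoly where
  "var2 = [:[:0, 1:]:]"

definition specialize2 :: "bipoly \<Rightarrow> complex \<Rightarrow> complex poly" where
  "specialize2 p y = map_poly (\<lambda>c. poly c y) p"

definition eval2 :: "bipoly \<Rightarrow> complex \<times> complex \<Rightarrow> complex" where
  "eval2 p z = poly (specialize2 p (snd z)) (fst z)"

definition poly_map2 :: "bipoly \<times> bipoly \<Rightarrow> complex \<times> complex \<Rightarrow> complex \<times> complex" where
  "poly_map2 f z = (eval2 (fst f) z, eval2 (snd f) z)"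

definition keller :: "bipoly \<times> bipoly \<Rightarrow> bool" where
  "keller f \<longleftrightarrow>
     pderiv (fst f) * map_poly pderiv (snd f) - map_poly pderiv (fst f) * pderiv (snd f) = 1"

definition zariski :: "(complex \<times> complex) topology" where
  "zariski = topology_generated_by (range (\<lambda>p. {z. eval2 p z \<noteq> 0}))"

definition irreducible_set :: "(complex \<times> complex) set \<Rightarrow> bool" where
  "irreducible_set A \<longleftrightarrow> A \<noteq> {} \<and>
     (\<forall>B C. closedin zariski B \<and> closedin zariski C \<and> A \<subseteq> B \<union> C \<longrightarrow> A \<subseteq> B \<or> A \<subseteq> C)"

definition irreducible_component ::
  "(complex \<times> complex) set \<Rightarrow> (complex \<times> complex) set \<Rightarrow> bool" where
  "irreducible_component V W \<longleftrightarrow> V \<subseteq> W \<and> irreducible_set V \<and>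
     (\<forall>V'. irreducible_set V' \<and> V \<subseteq> V' \<and> V' \<subseteq> W \<longrightarrow> V' = V)"

text \<open>
  Codimension one, for an irreducible set \<open>V\<close>: the only irreducible closed set strictly above
  \<open>V\<close> is the plane itself.
\<close>

definition codim_one :: "(complex \<times> complex) set \<Rightarrow> bool" where
  "codim_one V \<longleftrightarrow> closedin zariski V \<and> V \<noteq> UNIV \<and>
     (\<forall>W. closedin zariski W \<and> irreducible_set W \<and> V \<subset> W \<longrightarrow> W = UNIV)"

text \<open>
  The points without a neighbourhood (in the usual topology) over which the map is proper.
\<close>

definition nonproper_set :: "(complex \<times> complex \<Rightarrow> complex \<times> complex) \<Rightarrow> (complex \<times> complex) set" where
  "nonproper_set F = {y. \<not> (\<exists>U. open U \<and> y \<in> U \<and>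
     proper_map (top_of_set (F -` U)) (top_of_set U) F)}"

text \<open>
  The chart \<open>X\<^sub>1 \<noteq> 0\<close> of the projective plane has coordinates \<open>(g, t) = (T/X\<^sub>1, X\<^sub>2/X\<^sub>1)\<close>.
  The blowup of an affine chart with coordinates \<open>(g, t)\<close> at its point \<open>(a, b)\<close> is covered by
  two affine charts, with new coordinates \<open>(g', t')\<close> such that
    \<open>g = a + g', t = b + g' t'\<close>   or   \<open>g = a + g' t', t = b + g'\<close>.
  In both of them \<open>g' = 0\<close> is the exceptional curve and \<open>t'\<close> is a coordinate on it.
  A blowup step records the chart of the blowup that is retained and the centre \<open>(a, b)\<close>.
\<close>

datatype blowup_chart = Chart_g | Chart_t

type_synonym blowup_step = "blowup_chart \<times> complex \<times> complex"

fun blow_down :: "blowup_step \<Rightarrow> bipoly \<times> bipoly \<Rightarrow> bipoly \<times> bipoly" where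
  "blow_down (Chart_g, a, b) (G, H) = (const2 a + G, const2 b + G * H)"
| "blow_down (Chart_t, a, b) (G, H) = (const2 a + G * H, const2 b + G)"

text \<open>
  The functions \<open>(T/X\<^sub>1, X\<^sub>2/X\<^sub>1)\<close> as polynomials in the coordinates of the last chart. The head of
  the list is the first blowup; on the last chart the first variable is \<open>g\<close>, whose zero set is
  the last exceptional curve \<open>\<Gamma>\<close>, and the second variable is the coordinate \<open>e\<close> on \<open>\<Gamma>\<close>.
\<close>

definition chart_coords :: "blowup_step list \<Rightarrow> bipoly \<times> bipoly" where
  "chart_coords bs = foldr blow_down bs (var1, var2)"

definition Z_poly :: "blowup_step list \<Rightarrow> bipoly" where
  "Z_poly bs = fst (chart_coords bs)"

definition Q_poly :: "blowup_step list \<Rightarrow> bipoly" where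
  "Q_poly bs = snd (chart_coords bs)"

text \<open>
  At least one blowup, and each centre lies over the line at infinity \<open>T = 0\<close>. In particular the
  first centre has coordinates \<open>(0, \<alpha>\<^sub>1)\<close>, i.e. it is the point \<open>[1 : \<alpha>\<^sub>1 : 0]\<close>.
\<close>

definition blowup_sequence :: "blowup_step list \<Rightarrow> bool" where
  "blowup_sequence bs \<longleftrightarrow> bs \<noteq> [] \<and>
     (\<forall>i < length bs. eval2 (Z_poly (take i bs)) (snd (bs ! i)) = 0)"

text \<open>The point \<open>[X\<^sub>1 : X\<^sub>2 : T]\<close> with \<open>T \<noteq> 0\<close>, in the affine coordinates \<open>x\<^sub>i = X\<^sub>i/T\<close>.\<close>

definition affine_point :: "complex \<Rightarrow> complex \<Rightarrow> complex \<Rightarrow> complex \<times> complex" where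
  "affine_point X1 X2 T = (X1 / T, X2 / T)"

text \<open>
  \<open>[A\<^sub>1 : A\<^sub>2 : A\<^sub>0]\<close> are homogeneous coordinates, polynomial on the last chart, of the rational map
  to the projective plane \<open>Y\<close> that extends \<open>f\<close>.
\<close>

definition represents ::
  "bipoly \<times> bipoly \<Rightarrow> blowup_step list \<Rightarrow> bipoly \<Rightarrow> bipoly \<Rightarrow> bipoly \<Rightarrow> bool" where
  "represents f bs A1 A2 A0 \<longleftrightarrow> A0 \<noteq> 0 \<and>
     (\<forall>z. eval2 (Z_poly bs) z \<noteq> 0 \<longrightarrow>
        (eval2 A1 z, eval2 A2 z) =
          (let y = poly_map2 f (affine_point 1 (eval2 (Q_poly bs) z) (eval2 (Z_poly bs) z))
           in (eval2 A0 z * fst y, eval2 A0 z * snd y)))"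

definition defined_at :: "bipoly \<times> bipoly \<Rightarrow> blowup_step list \<Rightarrow> complex \<Rightarrow> bool" where
  "defined_at f bs e \<longleftrightarrow> (\<exists>A1 A2 A0. represents f bs A1 A2 A0 \<and>
     (eval2 A1 (0, e), eval2 A2 (0, e), eval2 A0 (0, e)) \<noteq> (0, 0, 0))"

text \<open>The point \<open>e\<close> of \<open>\<Gamma>\<close> is mapped to the point \<open>y\<close> of the affine plane \<open>Y\<^sub>0\<close>.\<close>

definition maps_to :: "bipoly \<times> bipoly \<Rightarrow> blowup_step list \<Rightarrow> complex \<Rightarrow> complex \<times> complex \<Rightarrow> bool" where
  "maps_to f bs e y \<longleftrightarrow> (\<exists>A1 A2 A0. represents f bs A1 A2 A0 \<and> eval2 A0 (0, e) \<noteq> 0 \<and>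
     y = affine_point (eval2 A1 (0, e)) (eval2 A2 (0, e)) (eval2 A0 (0, e)))"

text \<open>
  \<open>\<Gamma>\<close> is mapped densely onto \<open>V\<close>: the part of the image in \<open>Y\<^sub>0\<close> is contained in the closed curve
  \<open>V\<close> and dense in it.
\<close>

definition dominates :: "bipoly \<times> bipoly \<Rightarrow> blowup_step list \<Rightarrow> (complex \<times> complex) set \<Rightarrow> bool" where
  "dominates f bs V \<longleftrightarrow> (MOST e. defined_at f bs e) \<and>
     zariski closure_of {y. \<exists>e. maps_to f bs e y} = V"

definition generic_order :: "blowup_step list \<Rightarrow> nat \<Rightarrow> bool" where
  "generic_order bs m \<longleftrightarrow>
     (MOST e. specialize2 (Z_poly bs) e \<noteq> 0 \<and> order 0 (specialize2 (Z_poly bs) e) = m)"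

text \<open>A local parameter \<open>s\<close> at \<open>t = 0\<close>, as a power series in \<open>t\<close>, with \<open>s\<^sup>m = Z\<^sub>e(t)\<close>.\<close>

definition local_param :: "blowup_step list \<Rightarrow> nat \<Rightarrow> complex \<Rightarrow> complex fps \<Rightarrow> bool" where
  "local_param bs m e s \<longleftrightarrow> fps_nth s 0 = 0 \<and> fps_nth s 1 \<noteq> 0 \<and>
     s ^ m = fps_of_poly (specialize2 (Z_poly bs) e)"

definition expansion :: "blowup_step list \<Rightarrow> nat \<Rightarrow> complex \<Rightarrow> complex fps \<Rightarrow> bool" where
  "expansion bs m e \<beta> \<longleftrightarrow> (\<exists>s. local_param bs m e s \<and>
     fps_compose \<beta> s = fps_of_poly (specialize2 (Q_poly bs) e))"

text \<open>
  For each \<open>e\<close> the parameter \<open>s\<^sub>e\<close> is determined only up to an \<open>m\<close>-th root of unity \<open>\<zeta>\<close>, and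
  replacing \<open>s\<^sub>e\<close> by \<open>\<zeta> s\<^sub>e\<close> replaces \<open>\<beta>\<^sub>i(e)\<close> by \<open>\<zeta>\<^sup>-\<^sup>i \<beta>\<^sub>i(e)\<close>; in general there is no choice of
  \<open>s\<^sub>e\<close> that is continuous in all \<open>e\<close>. So \<open>\<beta>\<^sub>i\<close> is a multivalued (algebraic) function of \<open>e\<close>; it is
  constant if it takes one and the same value for suitable choices of the \<open>s\<^sub>e\<close>. As \<open>\<beta>\<^sub>i\<^sup>m\<close> is
  single-valued, this holds iff the holomorphic branches of \<open>\<beta>\<^sub>i\<close> are constant.
\<close>

definition coeff_constant :: "blowup_step list \<Rightarrow> nat \<Rightarrow> nat \<Rightarrow> bool" where
  "coeff_constant bs m i \<longleftrightarrow> (\<exists>c. MOST e. \<exists>\<beta>. expansion bs m e \<beta> \<and> fps_nth \<beta> i = c)"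

definition first_nonconstant :: "blowup_step list \<Rightarrow> nat \<Rightarrow> nat \<Rightarrow> bool" where
  "first_nonconstant bs m N \<longleftrightarrow> \<not> coeff_constant bs m N \<and> (\<forall>i < N. coeff_constant bs m i)"

definition truncated_curve :: "nat \<Rightarrow> nat \<Rightarrow> complex fps \<Rightarrow> complex \<Rightarrow> complex \<times> complex" where
  "truncated_curve m N \<beta> s = affine_point 1 (\<Sum>i\<le>N. fps_nth \<beta> i * s ^ i) (s ^ m)"

end

theory Submission
  imports Defs
begin

text \<open>
  The argument is purely formal. Write \<open>s\<^sub>e = \<omega> \<sigma>\<^sub>e\<close>, where \<open>\<omega>\<^sup>m\<close> is the leading coefficient \<open>w(e)\<close> of
  \<open>Z\<^sub>e\<close> and \<open>\<sigma>\<^sub>e\<close> is a power series in \<open>t\<close> with coefficients rational in \<open>e\<close>. Then \<open>\<beta>\<^sub>i = b\<^sub>i(e) / \<omega>\<^sup>i\<close> with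
  \<open>b\<^sub>i\<close> rational, so \<open>\<beta>\<^sub>i\<^sup>m\<close> is rational, and \<open>\<beta>\<^sub>i\<close> is constant as soon as it repeats one value infinitely
  often. In particular only finitely many truncations \<open>R = \<Sum>i<N. \<beta>\<^sub>i s\<^sup>i\<close> occur, and for each one that
  occurs for infinitely many \<open>e\<close> the coefficient \<open>\<beta>\<^sub>N\<close> takes infinitely many values.

  Fix such an \<open>R\<close> and a component \<open>p\<close> of \<open>f\<close>. For large \<open>K\<close> the expression
  \<open>G(s, x) = s\<^sup>K p(1/s\<^sup>m, (R + s\<^sup>N x)/s\<^sup>m)\<close> is a polynomial. As \<open>f\<close> is regular at the point \<open>e\<close> of \<open>\<Gamma>\<close>,
  \<open>s\<^sup>K\<close> divides \<open>G(s, h)\<close> for the series \<open>h = \<beta>\<^sub>N + \<beta>\<^sub>N\<^sub>+\<^sub>1 s + \<dots>\<close>. The lowest coefficient of \<open>G\<close> in \<open>s\<close> is a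
  polynomial in \<open>x\<close>, and would vanish at the infinitely many values \<open>\<beta>\<^sub>N\<close> if its order were below \<open>K\<close>. Hence
  \<open>s\<^sup>K\<close> divides \<open>G(s, x)\<close>, and at \<open>s = 0\<close> the quotient has the same value for \<open>x = h\<close>
  and for \<open>x = \<beta>\<^sub>N\<close>.
\<close>

section \<open>Functions of \<open>e\<close> that are rational off a finite set\<close>

text \<open>Clearing the denominator and ignoring finitely many \<open>e\<close> makes the values
  that division takes at poles harmless.\<close>

definition gen_rational :: "(complex \<Rightarrow> complex) \<Rightarrow> bool" where
  "gen_rational r \<longleftrightarrow> (\<exists>p q. q \<noteq> 0 \<and> (MOST e. r e * poly q e = poly p e))"

lemma MOST_poly_nonzero:
  fixes p :: "'a::idom poly"
  assumes "p \<noteq> 0"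
  shows "MOST x. poly p x \<noteq> 0"
  using poly_roots_finite[OF assms] by (simp add: MOST_iff_cofinite)

lemma poly_eqI_infinite:
  fixes p q :: "'a::idom poly"
  assumes "infinite S" "\<And>x. x \<in> S \<Longrightarrow> poly p x = poly q x"
  shows "p = q"
proof (rule ccontr)
  assume "p \<noteq> q"
  then have "finite {x. poly (p - q) x = 0}"
    by (intro poly_roots_finite) simp
  then have "finite S"
    by (rule finite_subset[rotated]) (use assms in auto)
  then show False using assms by simp
qed

lemma infinite_MOST_conj:
  assumes "infinite S" "MOST x. P x"
  shows "infinite {x \<in> S. P x}"
proof
  assume "finite {x \<in> S. P x}"
  moreover have "finite {x. \<not> P x}" using assms(2) by (simp add: MOST_iff_cofinite)
  ultimately have "finite ({x \<in> S. P x} \<union> {x. \<not> P x})" by simp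
  then have "finite S" by (rule finite_subset[rotated]) auto
  then show False using assms by simp
qed

lemma gen_rational_poly: "gen_rational (poly p)"
  unfolding gen_rational_def by (rule exI[of _ p], rule exI[of _ 1]) simp

lemma gen_rational_const: "gen_rational (\<lambda>e. c)"
proof -
  have "poly [:c:] = (\<lambda>e. c)" by auto
  then show ?thesis using gen_rational_poly[of "[:c:]"] by simp
qed

lemma gen_rational_add:
  assumes "gen_rational r" "gen_rational r'"
  shows "gen_rational (\<lambda>e. r e + r' e)"
proof -
  obtain p q where pq: "q \<noteq> 0" "MOST e. r e * poly q e = poly p e"
    using assms(1) by (auto simp: gen_rational_def)
  obtain p' q' where pq': "q' \<noteq> 0" "MOST e. r' e * poly q' e = poly p' e"
    using assms(2) by (auto simp: gen_rational_def)
  have "MOST e. (r e + r' e) * poly (q * q') e = poly (p * q' + p' * q) e"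
    using pq(2) pq'(2)
  proof eventually_elim
    case (elim e)
    have "(r e + r' e) * poly (q * q') e =
          (r e * poly q e) * poly q' e + (r' e * poly q' e) * poly q e"
      by (simp add: algebra_simps)
    then show ?case by (simp add: elim)
  qed
  then show ?thesis using pq(1) pq'(1) unfolding gen_rational_def
    by (intro exI[of _ "p * q' + p' * q"] exI[of _ "q * q'"]) simp
qed

lemma gen_rational_mult:
  assumes "gen_rational r" "gen_rational r'"
  shows "gen_rational (\<lambda>e. r e * r' e)"
proof -
  obtain p q where pq: "q \<noteq> 0" "MOST e. r e * poly q e = poly p e"
    using assms(1) by (auto simp: gen_rational_def)
  obtain p' q' where pq': "q' \<noteq> 0" "MOST e. r' e * poly q' e = poly p' e"
    using assms(2) by (auto simp: gen_rational_def)
  have "MOST e. (r e * r' e) * poly (q * q') e = poly (p * p') e"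
    using pq(2) pq'(2)
  proof eventually_elim
    case (elim e)
    have "(r e * r' e) * poly (q * q') e = (r e * poly q e) * (r' e * poly q' e)"
      by (simp add: algebra_simps)
    then show ?case by (simp add: elim)
  qed
  then show ?thesis using pq(1) pq'(1) unfolding gen_rational_def
    by (intro exI[of _ "p * p'"] exI[of _ "q * q'"]) simp
qed

lemma gen_rational_diff:
  assumes "gen_rational r" "gen_rational r'"
  shows "gen_rational (\<lambda>e. r e - r' e)"
  using gen_rational_add[OF assms(1) gen_rational_mult[OF gen_rational_const[of "-1"] assms(2)]]
  by simp

lemma gen_rational_sum:
  assumes "\<And>i. i \<in> A \<Longrightarrow> gen_rational (r i)"
  shows "gen_rational (\<lambda>e. \<Sum>i\<in>A. r i e)"
  using assms
  by (induction A rule: infinite_finite_induct)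
     (auto intro: gen_rational_add gen_rational_const)

lemma gen_rational_divide_poly:
  assumes "gen_rational r" "w \<noteq> 0"
  shows "gen_rational (\<lambda>e. r e / poly w e)"
proof -
  obtain p q where pq: "q \<noteq> 0" "MOST e. r e * poly q e = poly p e"
    using assms(1) by (auto simp: gen_rational_def)
  have "MOST e. r e / poly w e * poly (q * w) e = poly p e"
    using pq(2) MOST_poly_nonzero[OF assms(2)] by eventually_elim simp
  then show ?thesis using pq(1) assms(2) unfolding gen_rational_def
    by (intro exI[of _ p] exI[of _ "q * w"]) simp
qed

lemma gen_rational_fps_mult:
  assumes "\<And>n. gen_rational (\<lambda>e. fps_nth (F e) n)" "\<And>n. gen_rational (\<lambda>e. fps_nth (G e) n)"
  shows "gen_rational (\<lambda>e. fps_nth (F e * G e) n)"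
  unfolding fps_mult_nth by (intro gen_rational_sum gen_rational_mult assms)

lemma gen_rational_fps_power:
  assumes "\<And>n. gen_rational (\<lambda>e. fps_nth (F e) n)"
  shows "gen_rational (\<lambda>e. fps_nth (F e ^ k) n)"
proof (induction k arbitrary: n)
  case 0
  then show ?case by (cases "n = 0") (auto intro: gen_rational_const)
next
  case (Suc k)
  then show ?case by (auto intro: gen_rational_fps_mult assms)
qed

lemma gen_rational_fps_compose:
  assumes "\<And>n. gen_rational (\<lambda>e. fps_nth (F e) n)" "\<And>n. gen_rational (\<lambda>e. fps_nth (G e) n)"
  shows "gen_rational (\<lambda>e. fps_nth (fps_compose (F e) (G e)) n)"
  unfolding fps_compose_nth
  by (intro gen_rational_sum gen_rational_mult gen_rational_fps_power assms)

section \<open>Normal form of the local parameters and of the expansions\<close>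

text \<open>In \<open>a^m - b^m = (a - b) * S\<close> the constant term of \<open>S\<close> is
  \<open>m\<close> times a power of the constant term of \<open>b\<close>, hence nonzero in
  characteristic 0.\<close>

lemma fps_power_eq_imp_eq:
  fixes a b :: "'a::field_char_0 fps"
  assumes "a ^ m = b ^ m" "m \<ge> 1" "fps_nth a 0 = fps_nth b 0" "fps_nth b 0 \<noteq> 0"
  shows "a = b"
proof -
  obtain k where k: "m = Suc k" using assms(2) by (cases m) auto
  let ?S = "\<Sum>p<Suc k. a ^ p * b ^ (k - p)"
  have "(a - b) * ?S = 0"
    using assms(1) diff_power_eq_sum[of a k b] k by simp
  moreover have "fps_nth ?S 0 = of_nat (Suc k) * fps_nth b 0 ^ k"
  proof -
    have "fps_nth ?S 0 = (\<Sum>p<Suc k. fps_nth b 0 ^ k)"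
      unfolding fps_sum_nth
      by (rule sum.cong) (auto simp: assms(3) fps_nth_power_0 simp flip: power_add)
    then show ?thesis by simp
  qed
  then have "?S \<noteq> 0" using assms(4) by (metis fps_zero_nth mult_eq_0_iff of_nat_eq_0_iff nat.simps(3) power_not_zero)
  ultimately show ?thesis by simp
qed

lemma coeff_specialize2: "coeff (specialize2 p y) n = poly (coeff p n) y"
  by (simp add: specialize2_def coeff_map_poly)

definition lead_poly :: "blowup_step list \<Rightarrow> nat \<Rightarrow> complex poly" where
  "lead_poly bs m = coeff (Z_poly bs) m"

text \<open>This is \<open>Z_e / (w t^m) - 1\<close> when \<open>Z_e\<close> has order
  \<open>m\<close>. The constant term is set to 0 outright, so that the series is a legitimate inner
  argument of \<open>fps_compose\<close> at every \<open>e\<close>.\<close>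

definition tail_fps :: "blowup_step list \<Rightarrow> nat \<Rightarrow> complex \<Rightarrow> complex fps" where
  "tail_fps bs m e =
     Abs_fps (\<lambda>j. if j = 0 then 0 else poly (coeff (Z_poly bs) (m + j)) e / poly (lead_poly bs m) e)"

definition unit_root :: "blowup_step list \<Rightarrow> nat \<Rightarrow> complex \<Rightarrow> complex fps" where
  "unit_root bs m e = fps_compose (fps_binomial (1 / of_nat m)) (tail_fps bs m e)"

text \<open>This is the series \<open>\<sigma>\<^sub>e\<close>. Its linear coefficient 1 makes it
  invertible under composition at every \<open>e\<close>.\<close>

definition unit_param :: "blowup_step list \<Rightarrow> nat \<Rightarrow> complex \<Rightarrow> complex fps" where
  "unit_param bs m e = fps_X * unit_root bs m e"

text \<open>Its coefficients are the functions \<open>b\<^sub>i(e)\<close>.\<close>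

definition unit_expansion :: "blowup_step list \<Rightarrow> nat \<Rightarrow> complex \<Rightarrow> complex fps" where
  "unit_expansion bs m e =
     fps_compose (fps_of_poly (specialize2 (Q_poly bs) e)) (fps_inv (unit_param bs m e))"

lemma unit_root_nth_0: "fps_nth (unit_root bs m e) 0 = 1"
  by (simp add: unit_root_def)

lemma unit_root_power:
  assumes "m \<ge> 1"
  shows "unit_root bs m e ^ m = 1 + tail_fps bs m e"
proof -
  have "fps_nth (tail_fps bs m e) 0 = 0" by (simp add: tail_fps_def)
  then have "unit_root bs m e ^ m = fps_compose (fps_binomial (1 / of_nat m) ^ m) (tail_fps bs m e)"
    by (simp add: unit_root_def fps_compose_power)
  also have "fps_binomial (1 / of_nat m :: complex) ^ m = 1 + fps_X"
    using assms by (simp add: fps_binomial_power fps_binomial_1)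
  finally show ?thesis
    by (simp add: fps_compose_add_distrib \<open>fps_nth (tail_fps bs m e) 0 = 0\<close>)
qed

lemma unit_param_nth [simp]:
  "fps_nth (unit_param bs m e) 0 = 0" "fps_nth (unit_param bs m e) (Suc 0) = 1"
  by (simp_all add: unit_param_def unit_root_nth_0)

lemma unit_param_power_nth: "fps_nth (unit_param bs m e ^ n) n = 1"
  by (simp add: unit_param_def power_mult_distrib fps_X_power_mult_nth unit_root_nth_0 fps_nth_power_0)

lemma unit_expansion_compose:
  "fps_compose (unit_expansion bs m e) (unit_param bs m e) = fps_of_poly (specialize2 (Q_poly bs) e)"
  unfolding unit_expansion_def
  by (subst fps_compose_assoc[symmetric]) (simp_all add: fps_inv, simp add: fps_inv_def)

lemma gen_rational_unit_param:
  assumes "lead_poly bs m \<noteq> 0"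
  shows "gen_rational (\<lambda>e. fps_nth (unit_param bs m e) n)"
proof -
  have tail: "gen_rational (\<lambda>e. fps_nth (tail_fps bs m e) n)" for n
    using gen_rational_divide_poly[OF gen_rational_poly assms]
    by (cases "n = 0") (auto simp: tail_fps_def intro: gen_rational_const)
  show ?thesis
    unfolding unit_param_def unit_root_def
    by (intro gen_rational_fps_mult gen_rational_fps_compose tail gen_rational_const)
qed

text \<open>Since \<open>\<sigma>^n\<close> starts with \<open>t^n\<close>, comparing coefficients
  of \<open>t^n\<close> in \<open>unit_expansion_compose\<close> gives a triangular recursion; this
  avoids a formula for the inverse series.\<close>

lemma gen_rational_unit_expansion:
  assumes "lead_poly bs m \<noteq> 0"
  shows "gen_rational (\<lambda>e. fps_nth (unit_expansion bs m e) n)"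
proof (induction n rule: less_induct)
  case (less n)
  have "fps_nth (unit_expansion bs m e) n =
          poly (coeff (Q_poly bs) n) e -
          (\<Sum>i<n. fps_nth (unit_expansion bs m e) i * fps_nth (unit_param bs m e ^ i) n)" for e
  proof -
    have "poly (coeff (Q_poly bs) n) e =
            (\<Sum>i\<in>{0..n}. fps_nth (unit_expansion bs m e) i * fps_nth (unit_param bs m e ^ i) n)"
      using arg_cong[OF unit_expansion_compose[of bs m e], of "\<lambda>F. fps_nth F n"]
      by (simp add: fps_compose_nth coeff_specialize2)
    also have "{0..n} = insert n {..<n}" by auto
    finally show ?thesis by (simp add: unit_param_power_nth)
  qed
  then show ?case
    by (simp only:)
       (intro gen_rational_diff gen_rational_poly gen_rational_sum gen_rational_mult
          gen_rational_fps_power gen_rational_unit_param less assms; simp)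
qed

lemma coeff_order_0:
  fixes p :: "'a::idom poly"
  assumes "p \<noteq> 0"
  shows "coeff p (order 0 p) \<noteq> 0" "n < order 0 p \<Longrightarrow> coeff p n = 0"
proof -
  obtain q where q: "p = [:-0, 1:] ^ order 0 p * q" "\<not> [:-0, 1:] dvd q"
    using order_decomp[OF assms, of 0] by blast
  have p: "p = monom 1 (order 0 p) * q"
    using q(1) by (simp add: monom_altdef)
  have "coeff q 0 \<noteq> 0"
    using q(2) poly_eq_0_iff_dvd[of q 0] by (simp add: poly_0_coeff_0)
  then show "coeff p (order 0 p) \<noteq> 0"
    by (subst p) (simp add: coeff_monom_mult)
  show "coeff p n = 0" if "n < order 0 p"
    using that by (subst p) (simp add: coeff_monom_mult)
qed

text \<open>A local parameter is \<open>t\<close> times a unit \<open>a\<close> with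
  \<open>a^m = w v^m\<close>, where \<open>v\<close> is the unit root; uniqueness of roots with
  given constant term forces \<open>s = \<omega> \<sigma>\<close>. So the only freedom is the choice
  of \<omega>.\<close>

lemma expansion_iff:
  assumes m: "m \<ge> 1" and ord: "order 0 (specialize2 (Z_poly bs) e) = m"
    and nz: "specialize2 (Z_poly bs) e \<noteq> 0"
  shows "expansion bs m e \<beta> \<longleftrightarrow>
    (\<exists>\<omega>. \<omega> ^ m = poly (lead_poly bs m) e \<and>
         (\<forall>i. fps_nth (unit_expansion bs m e) i = \<omega> ^ i * fps_nth \<beta> i))"
proof -
  define w where "w = poly (lead_poly bs m) e"
  let ?Z = "specialize2 (Z_poly bs) e"
  let ?v = "unit_root bs m e" and ?\<sigma> = "unit_param bs m e" and ?b = "unit_expansion bs m e"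
  have w: "w \<noteq> 0"
    using coeff_order_0(1)[OF nz] ord by (simp add: w_def lead_poly_def coeff_specialize2)
  have Z: "fps_of_poly ?Z = fps_X ^ m * (fps_const w * ?v ^ m)"
  proof (rule fps_ext)
    fix n
    show "fps_nth (fps_of_poly ?Z) n = fps_nth (fps_X ^ m * (fps_const w * ?v ^ m)) n"
    proof (cases "n < m")
      case True
      then show ?thesis
        using coeff_order_0(2)[OF nz] ord by (simp add: fps_X_power_mult_nth)
    next
      case False
      then show ?thesis using w
        by (auto simp: fps_X_power_mult_nth unit_root_power[OF m] tail_fps_def coeff_specialize2
                       w_def[symmetric])
           (auto simp: w_def lead_poly_def)
    qed
  qed
  \<comment> \<open>Rescaling the inner series by \<omega> amounts to rescaling the variable of
    \<beta>, and composition with \<sigma> is injective.\<close>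
  have scale: "fps_compose \<beta> (fps_const \<omega> * ?\<sigma>) = fps_of_poly (specialize2 (Q_poly bs) e) \<longleftrightarrow>
      (\<forall>i. fps_nth ?b i = \<omega> ^ i * fps_nth \<beta> i)" for \<omega>
  proof -
    have "fps_compose (fps_compose \<beta> (fps_const \<omega> * fps_X)) ?\<sigma> =
          fps_compose \<beta> (fps_compose (fps_const \<omega> * fps_X) ?\<sigma>)"
      by (rule fps_compose_assoc[symmetric]) simp_all
    also have "fps_compose (fps_const \<omega> * fps_X) ?\<sigma> = fps_const \<omega> * ?\<sigma>"
      by (simp add: fps_compose_mult_distrib)
    finally have *: "fps_compose (fps_compose \<beta> (fps_const \<omega> * fps_X)) ?\<sigma> =
          fps_compose \<beta> (fps_const \<omega> * ?\<sigma>)" .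
    have "fps_compose \<beta> (fps_const \<omega> * ?\<sigma>) = fps_of_poly (specialize2 (Q_poly bs) e) \<longleftrightarrow>
          fps_compose \<beta> (fps_const \<omega> * fps_X) = ?b"
      unfolding *[symmetric] unit_expansion_compose[of bs m e, symmetric]
      by (rule fps_compose_inj_right) simp_all
    then show ?thesis by (auto simp: fps_compose_linear fps_eq_iff)
  qed
  show ?thesis
  proof
    assume "expansion bs m e \<beta>"
    then obtain s where s: "fps_nth s 0 = 0" "fps_nth s 1 \<noteq> 0" "s ^ m = fps_of_poly ?Z"
        "fps_compose \<beta> s = fps_of_poly (specialize2 (Q_poly bs) e)"
      by (auto simp: expansion_def local_param_def)
    define a where "a = fps_shift 1 s"
    define \<omega> where "\<omega> = fps_nth a 0"
    have sa: "s = fps_X * a"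
      using s(1) fps_shift_cutoff'[of 1 s] by (simp add: a_def fps_eq_iff fps_X_mult_nth)
    have "fps_X ^ m * a ^ m = fps_X ^ m * (fps_const w * ?v ^ m)"
      using s(3) Z by (simp add: sa power_mult_distrib)
    then have am: "a ^ m = fps_const w * ?v ^ m" by simp
    have \<omega>: "\<omega> ^ m = w"
      using arg_cong[OF am, of "\<lambda>F. fps_nth F 0"]
      by (simp add: fps_nth_power_0 unit_root_nth_0 \<omega>_def)
    have "a = fps_const \<omega> * ?v"
    proof (rule fps_power_eq_imp_eq)
      show "a ^ m = (fps_const \<omega> * ?v) ^ m"
        by (simp add: am power_mult_distrib fps_const_power \<omega>)
      show "fps_nth (fps_const \<omega> * ?v) 0 \<noteq> 0"
        using \<omega> w m by (auto simp: unit_root_nth_0 power_0_left)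
    qed (use m in \<open>auto simp: \<omega>_def unit_root_nth_0\<close>)
    then have "s = fps_const \<omega> * ?\<sigma>" by (simp add: sa unit_param_def mult_ac)
    then show "\<exists>\<omega>. \<omega> ^ m = poly (lead_poly bs m) e \<and>
         (\<forall>i. fps_nth (unit_expansion bs m e) i = \<omega> ^ i * fps_nth \<beta> i)"
      using s(4) scale[of \<omega>] \<omega> w_def by auto
  next
    assume "\<exists>\<omega>. \<omega> ^ m = poly (lead_poly bs m) e \<and>
         (\<forall>i. fps_nth (unit_expansion bs m e) i = \<omega> ^ i * fps_nth \<beta> i)"
    then obtain \<omega> where \<omega>: "\<omega> ^ m = w" "\<forall>i. fps_nth ?b i = \<omega> ^ i * fps_nth \<beta> i"
      by (auto simp: w_def)
    have "local_param bs m e (fps_const \<omega> * ?\<sigma>)"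
      unfolding local_param_def
    proof (intro conjI)
      show "fps_nth (fps_const \<omega> * ?\<sigma>) 1 \<noteq> 0"
        using \<omega>(1) w m by (auto simp: power_0_left)
      show "(fps_const \<omega> * ?\<sigma>) ^ m = fps_of_poly ?Z"
        by (simp add: Z power_mult_distrib unit_param_def fps_const_power \<omega>(1) mult_ac)
    qed simp
    then show "expansion bs m e \<beta>"
      unfolding expansion_def using scale[of \<omega>] \<omega>(2) by blast
  qed
qed

section \<open>Roots of unity and constancy of a coefficient\<close>

text \<open>Off the zeros of \<open>q\<close> the quotient \<open>p / q\<close> takes values among
  the finitely many \<open>d\<close>-th roots of unity, so it takes one of them infinitely
  often.\<close>

lemma poly_power_eq_imp_root_of_unity:
  fixes p q :: "complex poly"
  assumes "p ^ d = q ^ d" "d \<ge> 1"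
  shows "\<exists>\<zeta>. \<zeta> ^ d = 1 \<and> p = smult \<zeta> q"
proof (cases "q = 0")
  case True
  then have "p = 0" using assms by (simp add: power_0_left)
  then show ?thesis using True by (intro exI[of _ 1]) simp
next
  case False
  define S where "S = {x. poly q x \<noteq> 0}"
  have "infinite S"
  proof
    assume "finite S"
    then have "finite (S \<union> {x. poly q x = 0})" using poly_roots_finite[OF False] by simp
    moreover have "S \<union> {x. poly q x = 0} = UNIV" by (auto simp: S_def)
    ultimately show False using infinite_UNIV_char_0[where 'a=complex] by simp
  qed
  have "poly p x / poly q x \<in> {z. z ^ d = 1}" if "x \<in> S" for x
    using that arg_cong[OF assms(1), of "\<lambda>r. poly r x"]
    by (simp add: S_def power_divide)
  then have "(\<lambda>x. poly p x / poly q x) ` S \<subseteq> {z. z ^ d = 1}" by auto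
  moreover have "finite {z::complex. z ^ d = 1}" using assms(2) by (intro finite_nth_roots) simp
  ultimately have "finite ((\<lambda>x. poly p x / poly q x) ` S)" by (rule finite_subset)
  from pigeonhole_infinite[OF \<open>infinite S\<close> this] obtain x0 where x0: "x0 \<in> S"
    "infinite {x \<in> S. poly p x / poly q x = poly p x0 / poly q x0}" by blast
  define \<zeta> where "\<zeta> = poly p x0 / poly q x0"
  have "p = smult \<zeta> q"
    by (rule poly_eqI_infinite[OF x0(2)]) (auto simp: S_def \<zeta>_def field_simps)
  moreover have "\<zeta> ^ d = 1"
    using \<open>\<And>x. x \<in> S \<Longrightarrow> poly p x / poly q x \<in> {z. z ^ d = 1}\<close>[OF x0(1)] by (simp add: \<zeta>_def)
  ultimately show ?thesis by blast
qed

lemma ex_nth_root_complex: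
  assumes "n \<ge> 1"
  shows "\<exists>z::complex. z ^ n = c"
  using exists_complex_root[of n c] assms by (auto intro: exI[of _ c])

text \<open>A \<open>gcd m i\<close>-th root \<theta> of \<eta> is an \<open>m\<close>-th root of
  unity, and the Bezout relation \<open>i x = m y + gcd m i\<close> shows that
  \<open>\<theta>^x\<close> has \<open>i\<close>-th power \<eta>.\<close>

lemma root_of_unity_gcd_power:
  fixes \<eta> :: complex
  assumes "\<eta> ^ (m div gcd m i) = 1" "m \<ge> 1"
  shows "\<exists>\<zeta>. \<zeta> ^ m = 1 \<and> \<zeta> ^ i = \<eta>"
proof (cases "i = 0")
  case True
  then show ?thesis using assms by (intro exI[of _ 1]) simp
next
  case False
  let ?d = "gcd m i"
  have d: "?d \<ge> 1" using assms(2) by (simp add: Suc_le_eq)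
  obtain \<theta> where \<theta>: "\<theta> ^ ?d = \<eta>" using ex_nth_root_complex[OF d] by blast
  have \<theta>m: "\<theta> ^ m = 1"
    using assms(1) by (simp flip: \<theta> power_mult)
  obtain x y where xy: "i * x = m * y + ?d"
    using bezout_nat[OF False, of m] by (auto simp: gcd.commute)
  have "(\<theta> ^ x) ^ m = 1"
    using \<theta>m by (metis mult.commute power_mult power_one)
  moreover have "(\<theta> ^ x) ^ i = \<eta>"
  proof -
    have "(\<theta> ^ x) ^ i = (\<theta> ^ m) ^ y * \<theta> ^ ?d"
      by (simp add: xy mult.commute add.commute flip: power_mult power_add)
    then show ?thesis by (simp add: \<theta>m \<theta>)
  qed
  ultimately show ?thesis by blast
qed

text \<open>
  A constant \<open>\<beta>\<^sub>i\<^sup>m\<close> is not enough: the values of \<open>\<beta>\<^sub>i\<close> at \<open>e\<close> form an orbit of \<open>{\<zeta>\<^sup>i | \<zeta>\<^sup>m = 1}\<close>, a group of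
  order \<open>m / gcd m i\<close>. So one first descends to a constant \<open>\<beta>\<^sub>i\<^sup>m\<^sup>'\<close> with \<open>m' = m / gcd m i\<close>, using that
  roots of rational functions are unique up to a constant root of unity; its \<open>m'\<close>-th roots are
  a single orbit.
\<close>

lemma coeff_constant_if_power_constant:
  assumes m: "m \<ge> 1" and gen: "generic_order bs m"
    and inf: "infinite {e. fps_nth (unit_expansion bs m e) i ^ m = C * poly (lead_poly bs m) e ^ i}"
  shows "coeff_constant bs m i"
proof -
  let ?w = "lead_poly bs m" and ?b = "\<lambda>e. fps_nth (unit_expansion bs m e) i"
  have gen': "MOST e. specialize2 (Z_poly bs) e \<noteq> 0 \<and> order 0 (specialize2 (Z_poly bs) e) = m"
    using gen by (simp add: generic_order_def)
  have w_nz: "MOST e. poly ?w e \<noteq> 0"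
    using gen'
    by eventually_elim
       (use coeff_order_0(1) in \<open>auto simp: lead_poly_def simp flip: coeff_specialize2\<close>)
  then have "?w \<noteq> 0"
    using infinite_UNIV_char_0[where 'a=complex] by (auto simp: MOST_iff_cofinite)
  from gen_rational_unit_expansion[OF this, of i] obtain p q where
    q: "q \<noteq> 0" and pq: "MOST e. ?b e * poly q e = poly p e"
    by (auto simp: gen_rational_def)
  define d where "d = gcd m i"
  define m' where "m' = m div d"
  define i' where "i' = i div d"
  have d: "d \<ge> 1" using m by (simp add: d_def Suc_le_eq)
  have m': "m = m' * d" and i': "i = i' * d" by (simp_all add: m'_def i'_def d_def)
  have m'1: "m' \<ge> 1" using m m' by (cases m') auto
  \<comment> \<open>Only the constant needs a \<open>d\<close>-th root: the exponents
    \<open>i\<close> and \<open>m\<close> are already multiples of \<open>d\<close>.\<close>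
  obtain c where c: "c ^ d = C" using ex_nth_root_complex[OF d] by blast
  have "(p ^ m') ^ d = (smult c (?w ^ i' * q ^ m')) ^ d"
  proof (rule poly_eqI_infinite[OF infinite_MOST_conj[OF inf pq]])
    fix e assume "e \<in> {e \<in> {e. ?b e ^ m = C * poly ?w e ^ i}. ?b e * poly q e = poly p e}"
    then have *: "?b e ^ m = C * poly ?w e ^ i" "poly p e = ?b e * poly q e" by auto
    have "poly ((p ^ m') ^ d) e = ?b e ^ m * poly q e ^ m"
      by (simp add: *(2) m' power_mult_distrib flip: power_mult)
    also have "\<dots> = c ^ d * poly ?w e ^ (i' * d) * poly q e ^ (m' * d)"
      by (simp only: *(1) c flip: i' m')
    also have "\<dots> = poly ((smult c (?w ^ i' * q ^ m')) ^ d) e"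
      by (simp add: power_mult_distrib power_mult)
    finally show "poly ((p ^ m') ^ d) e = poly ((smult c (?w ^ i' * q ^ m')) ^ d) e" .
  qed
  from poly_power_eq_imp_root_of_unity[OF this d] obtain \<xi> where
    "p ^ m' = smult \<xi> (smult c (?w ^ i' * q ^ m'))" by blast
  then obtain K where K: "p ^ m' = smult K (?w ^ i' * q ^ m')" by (metis smult_smult)
  obtain \<kappa> where \<kappa>: "\<kappa> ^ m' = K" using ex_nth_root_complex[OF m'1] by blast
  have "MOST e. \<exists>\<beta>. expansion bs m e \<beta> \<and> fps_nth \<beta> i = \<kappa>"
    using gen' w_nz pq MOST_poly_nonzero[OF q]
  proof eventually_elim
    case (elim e)
    have "?b e ^ m' * poly q e ^ m' = poly (p ^ m') e"
      using elim(3) by (simp flip: power_mult_distrib)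
    then have b: "?b e ^ m' = K * poly ?w e ^ i'"
      using elim(4) by (simp add: K)
    \<comment> \<open>For nonzero \<kappa>, an arbitrary root \<open>\<omega>0\<close> yields
      \<kappa> only up to an \<open>m'\<close>-th root of unity \<eta>; a factor \<zeta> with
      \<open>\<zeta>^i = \<eta>\<close> corrects this.\<close>
    obtain \<omega>0 where \<omega>0: "\<omega>0 ^ m = poly ?w e" using ex_nth_root_complex[OF m] by blast
    have \<omega>0_nz: "\<omega>0 \<noteq> 0" using \<omega>0 elim(2) m by (auto simp: power_0_left)
    have "\<exists>\<zeta>. \<zeta> ^ m = 1 \<and> ?b e = \<omega>0 ^ i * \<zeta> ^ i * \<kappa>"
    proof (cases "\<kappa> = 0")
      case True
      then have "?b e = 0" using b \<kappa> m'1 by (auto simp: power_0_left)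
      then show ?thesis using True by (intro exI[of _ 1]) simp
    next
      case False
      define \<eta> where "\<eta> = ?b e / (\<omega>0 ^ i * \<kappa>)"
      have "i * m' = m * i'" by (simp add: i' m')
      then have "\<omega>0 ^ (i * m') = poly ?w e ^ i'"
        by (simp add: power_mult \<omega>0)
      then have "\<eta> ^ m' = 1"
        using False \<kappa> \<omega>0_nz elim(2)
        by (auto simp: \<eta>_def power_divide power_mult_distrib b simp flip: power_mult)
      then obtain \<zeta> where "\<zeta> ^ m = 1" "\<zeta> ^ i = \<eta>"
        using root_of_unity_gcd_power[of \<eta> m i] m by (auto simp: m'_def d_def)
      then show ?thesis using False \<omega>0_nz by (intro exI[of _ \<zeta>]) (simp add: \<eta>_def)
    qed
    then obtain \<zeta> where \<zeta>: "\<zeta> ^ m = 1" "?b e = \<omega>0 ^ i * \<zeta> ^ i * \<kappa>" by blast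
    define \<omega> where "\<omega> = \<omega>0 * \<zeta>"
    have \<omega>: "\<omega> ^ m = poly ?w e" "\<omega> \<noteq> 0"
      using \<zeta>(1) \<omega>0 \<omega>0_nz m by (auto simp: \<omega>_def power_mult_distrib power_0_left)
    define \<beta> where "\<beta> = Abs_fps (\<lambda>j. fps_nth (unit_expansion bs m e) j / \<omega> ^ j)"
    have "expansion bs m e \<beta>"
      using elim(1) \<omega> m by (subst expansion_iff) (auto simp: \<beta>_def)
    moreover have "fps_nth \<beta> i = \<kappa>"
      using \<omega>(2) \<zeta>(2) by (simp add: \<beta>_def \<omega>_def power_mult_distrib)
    ultimately show ?case by blast
  qed
  then show ?thesis by (auto simp: coeff_constant_def)
qed

text \<open>Raising to the \<open>m\<close>-th power turns \<open>\<omega>^i\<close> into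
  \<open>w^i\<close>, which does not depend on the choice of the local parameter.\<close>

lemma expansion_nth_power:
  assumes "m \<ge> 1" "specialize2 (Z_poly bs) e \<noteq> 0" "order 0 (specialize2 (Z_poly bs) e) = m"
    and "expansion bs m e \<beta>"
  shows "fps_nth (unit_expansion bs m e) i ^ m = fps_nth \<beta> i ^ m * poly (lead_poly bs m) e ^ i"
proof -
  obtain \<omega> where \<omega>: "\<omega> ^ m = poly (lead_poly bs m) e"
    "fps_nth (unit_expansion bs m e) i = \<omega> ^ i * fps_nth \<beta> i"
    using assms expansion_iff[of m bs e \<beta>] by auto
  have "(\<omega> ^ i) ^ m = (\<omega> ^ m) ^ i" by (simp add: mult.commute flip: power_mult)
  then show ?thesis using \<omega> by (simp add: power_mult_distrib)
qed

section \<open>Clearing denominators along a curve\<close>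

text \<open>
  This is \<open>z\<^sup>2\<^sup>D p(1/z, q/z)\<close>, provided that \<open>p\<close> has degree at most \<open>D\<close> in each variable.
\<close>

definition homog ::
  "(complex \<Rightarrow> 'a::comm_ring_1) \<Rightarrow> bipoly \<Rightarrow> nat \<Rightarrow> 'a \<Rightarrow> 'a \<Rightarrow> 'a" where
  "homog \<kappa> p D z q = (\<Sum>i\<le>D. \<Sum>j\<le>D. \<kappa> (coeff (coeff p i) j) * q ^ j * z ^ (2 * D - i - j))"

definition bidegree_le :: "bipoly \<Rightarrow> nat \<Rightarrow> bool" where
  "bidegree_le p D \<longleftrightarrow> degree p \<le> D \<and> (\<forall>i. degree (coeff p i) \<le> D)"

lemma ex_bidegree_le: "\<exists>D. bidegree_le p D"
proof (intro exI)
  let ?D = "degree p + (\<Sum>i\<le>degree p. degree (coeff p i))"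
  have "degree (coeff p i) \<le> ?D" for i
  proof (cases "i \<le> degree p")
    case True
    then have "degree (coeff p i) \<le> (\<Sum>i\<le>degree p. degree (coeff p i))"
      by (intro member_le_sum) auto
    then show ?thesis by simp
  qed (simp add: coeff_eq_0)
  then show "bidegree_le p ?D" by (simp add: bidegree_le_def)
qed

lemma poly_eq_sum_le:
  fixes p :: "'a::comm_semiring_1 poly"
  assumes "degree p \<le> D"
  shows "poly p x = (\<Sum>i\<le>D. coeff p i * x ^ i)"
  unfolding poly_altdef
  by (rule sum.mono_neutral_left) (use assms in \<open>auto simp: coeff_eq_0\<close>)

lemma eval2_eq_sum:
  assumes "bidegree_le p D"
  shows "eval2 p (x, y) = (\<Sum>i\<le>D. \<Sum>j\<le>D. coeff (coeff p i) j * y ^ j * x ^ i)"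
proof -
  have "degree (specialize2 p y) \<le> D"
    using assms
    by (intro degree_le) (auto simp: coeff_specialize2 bidegree_le_def coeff_eq_0)
  then have "eval2 p (x, y) = (\<Sum>i\<le>D. poly (coeff p i) y * x ^ i)"
    by (simp add: eval2_def poly_eq_sum_le coeff_specialize2)
  also have "\<dots> = (\<Sum>i\<le>D. \<Sum>j\<le>D. coeff (coeff p i) j * y ^ j * x ^ i)"
    using assms by (simp add: poly_eq_sum_le[of _ D] bidegree_le_def sum_distrib_right)
  finally show ?thesis .
qed

lemma eval2_affine_point:
  assumes "bidegree_le p D" "z \<noteq> 0"
  shows "eval2 p (affine_point 1 q z) * z ^ (2 * D) = homog (\<lambda>a. a) p D z q"
proof -
  have "coeff (coeff p i) j * (q / z) ^ j * (1 / z) ^ i * z ^ (2 * D) =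
          coeff (coeff p i) j * q ^ j * z ^ (2 * D - i - j)" if "i \<le> D" "j \<le> D" for i j
  proof -
    \<comment> \<open>The subtraction \<open>2 * D - i - j\<close> is not cut off at 0, because
      \<open>i\<close> and \<open>j\<close> are at most \<open>D\<close>.\<close>
    have "z ^ (2 * D) = z ^ (2 * D - i - j) * z ^ i * z ^ j"
      using that by (simp flip: power_add)
    then show ?thesis using assms(2) by (simp add: power_divide)
  qed
  then show ?thesis
    unfolding affine_point_def eval2_eq_sum[OF assms(1)] homog_def sum_distrib_right
    by (intro sum.cong refl) auto
qed

text \<open>The same formula is needed over numbers, polynomials, power series and polynomials over
  power series; evaluation, embedding and composition carry one version to another.\<close>

lemma homog_map:
  assumes "\<And>x y. \<phi> (x + y) = \<phi> x + \<phi> y" "\<And>x y. \<phi> (x * y) = \<phi> x * \<phi> y"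
    and "\<phi> 0 = 0" "\<phi> 1 = 1"
  shows "\<phi> (homog \<kappa> p D z q) = homog (\<lambda>a. \<phi> (\<kappa> a)) p D (\<phi> z) (\<phi> q)"
proof -
  have sum: "\<phi> (\<Sum>i\<in>A. F i) = (\<Sum>i\<in>A. \<phi> (F i))" for F and A :: "nat set"
    by (induction A rule: infinite_finite_induct) (simp_all add: assms)
  have pow: "\<phi> (x ^ n) = \<phi> x ^ n" for x n
    by (induction n) (simp_all add: assms)
  show ?thesis by (simp add: homog_def sum pow assms)
qed

section \<open>Divisibility by powers of \<open>s\<close> and truncation\<close>

lemma fps_poly_nth_0:
  fixes g :: "'a::comm_ring_1 fps poly"
  shows "fps_nth (poly g h) 0 = fps_nth (poly g (fps_const (fps_nth h 0))) 0"
  by (simp add: poly_altdef fps_sum_nth fps_nth_power_0)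

text \<open>Induction on \<open>K\<close>: after \<open>K\<close> factors are removed, the constant
  terms of the coefficients of \<open>g'\<close> form a polynomial \<open>r\<close> that vanishes at
  the constant term of every \<open>h\<close> in \<open>H\<close>. These are infinitely many, so
  \<open>r = 0\<close> and a further factor comes out.\<close>

lemma fps_poly_X_power_factor:
  fixes g :: "'a::field_char_0 fps poly"
  assumes "infinite ((\<lambda>h. fps_nth h 0) ` H)"
    and "\<And>h k. h \<in> H \<Longrightarrow> k < K \<Longrightarrow> fps_nth (poly g h) k = 0"
  shows "\<exists>g'. g = smult (fps_X ^ K) g'"
  using assms(2)
proof (induction K)
  case 0
  then show ?case by (intro exI[of _ g]) simp
next
  case (Suc K)
  then obtain g' where g': "g = smult (fps_X ^ K) g'" by auto
  define r where "r = map_poly (\<lambda>a. fps_nth a 0) g'"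
  have r: "poly r x = fps_nth (poly g' (fps_const x)) 0" for x
  proof -
    have "degree r \<le> degree g'" by (intro degree_le) (auto simp: r_def coeff_map_poly coeff_eq_0)
    then have "poly r x = (\<Sum>i\<le>degree g'. fps_nth (coeff g' i) 0 * x ^ i)"
      by (simp add: poly_eq_sum_le r_def coeff_map_poly)
    then show ?thesis by (simp add: poly_altdef fps_sum_nth fps_nth_power_0)
  qed
  have "r = 0"
  proof (rule poly_eqI_infinite[OF assms(1)])
    fix x assume "x \<in> (\<lambda>h. fps_nth h 0) ` H"
    then obtain h where h: "h \<in> H" "x = fps_nth h 0" by auto
    have "fps_nth (poly g h) K = 0" using Suc.prems h(1) by simp
    then have "fps_nth (poly g' h) 0 = 0" by (simp add: g' fps_X_power_mult_nth)
    then show "poly r x = poly 0 x"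
      using fps_poly_nth_0[of g' h] by (simp add: r h(2))
  qed
  then have *: "fps_nth (coeff g' i) 0 = 0" for i
    using coeff_map_poly[of "\<lambda>a. fps_nth a 0" g' i] \<open>r = 0\<close> by (simp add: r_def)
  have "g' = smult fps_X (map_poly (fps_shift 1) g')"
  proof (rule poly_eqI)
    fix i
    show "coeff g' i = coeff (smult fps_X (map_poly (fps_shift 1) g')) i"
      using * [of i] by (simp add: coeff_map_poly fps_eq_iff)
  qed
  then have "g = smult (fps_X ^ Suc K) (map_poly (fps_shift 1) g')"
    by (subst g') (metis power_Suc2 smult_smult)
  then show ?case by blast
qed

text \<open>Once \<open>X^K\<close> is divided out of \<open>g\<close>, the constant term of the
  quotient at \<open>h\<close> depends on the constant term of \<open>h\<close> alone.\<close>

lemma fps_poly_truncate: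
  fixes g :: "'a::field_char_0 fps poly"
  assumes "infinite ((\<lambda>h. fps_nth h 0) ` H)"
    and "\<And>h k. h \<in> H \<Longrightarrow> k < K \<Longrightarrow> fps_nth (poly g h) k = 0"
  shows "k < K \<Longrightarrow> fps_nth (poly g h) k = 0"
    and "fps_nth (poly g (fps_const (fps_nth h 0))) K = fps_nth (poly g h) K"
proof -
  obtain g' where g': "g = smult (fps_X ^ K) g'"
    using fps_poly_X_power_factor[OF assms] by blast
  show "fps_nth (poly g h) k = 0" if "k < K"
    using that by (simp add: g' fps_X_power_mult_nth)
  show "fps_nth (poly g (fps_const (fps_nth h 0))) K = fps_nth (poly g h) K"
    using fps_poly_nth_0[of g' h] by (simp add: g' fps_X_power_mult_nth)
qed

lemma poly_divide_power_tendsto: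
  fixes T :: "complex poly"
  assumes "\<And>k. k < K \<Longrightarrow> coeff T k = 0"
  shows "((\<lambda>s. poly T s / s ^ K) \<longlongrightarrow> coeff T K) (at 0)"
proof -
  have T: "T = monom 1 K * poly_shift K T"
    by (rule poly_eqI) (auto simp: coeff_monom_mult coeff_poly_shift assms)
  have "((\<lambda>s. poly (poly_shift K T) s) \<longlongrightarrow> poly (poly_shift K T) 0) (at 0)"
    by (rule tendsto_poly) (rule tendsto_ident_at)
  moreover have "eventually (\<lambda>s. poly (poly_shift K T) s = poly T s / s ^ K) (at 0)"
    unfolding eventually_at_filter
    by (rule always_eventually) (subst (2) T, simp add: poly_monom)
  ultimately have "((\<lambda>s. poly T s / s ^ K) \<longlongrightarrow> poly (poly_shift K T) 0) (at 0)"
    by (rule Lim_transform_eventually)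
  then show ?thesis by (simp add: poly_0_coeff_0 coeff_poly_shift)
qed

text \<open>\<open>B\<close> is meant to collect expansions at different \<open>e\<close> with a
  common part below \<open>N\<close>. Their joint regularity forces the divisibility, which then
  applies to the truncation of each single \<beta>.\<close>

lemma truncated_curve_tendsto:
  assumes deg: "bidegree_le p D" and m: "m \<ge> 1"
    and pre: "\<And>\<beta> i. \<beta> \<in> B \<Longrightarrow> i < N \<Longrightarrow> fps_nth \<beta> i = c i"
    and inf: "infinite ((\<lambda>\<beta>. fps_nth \<beta> N) ` B)"
    and reg: "\<And>\<beta>. \<beta> \<in> B \<Longrightarrow> homog fps_const p D (fps_X ^ m) \<beta> = fps_X ^ (2 * D * m) * a \<beta>"
    and \<beta>: "\<beta> \<in> B"
  shows "((\<lambda>s. eval2 p (truncated_curve m N \<beta> s)) \<longlongrightarrow> fps_nth (a \<beta>) 0) (at 0)"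
proof -
  \<comment> \<open>With \<open>z = s^m\<close> the factor \<open>z^(2 * D)\<close> becomes
    \<open>s^K\<close>.\<close>
  define K where "K = 2 * D * m"
  define R where "R = (\<Sum>i<N. monom (c i) i)"
  \<comment> \<open>A polynomial in \<open>x\<close> over the power series in \<open>s\<close>; the
    last argument is \<open>R + s^N x\<close>.\<close>
  define g where "g = homog (\<lambda>a. [:fps_const a:]) p D [:fps_X ^ m:] [:fps_of_poly R, fps_X ^ N:]"
  have g: "poly g h = homog fps_const p D (fps_X ^ m) (fps_of_poly R + fps_X ^ N * h)" for h
    unfolding g_def by (subst homog_map[of "\<lambda>q. poly q h"]) (simp_all add: mult.commute)
  have coeff_R: "coeff R i = (if i < N then c i else 0)" for i
    by (simp add: R_def coeff_sum)
  have split: "\<beta> = fps_of_poly R + fps_X ^ N * fps_shift N \<beta>" if "\<beta> \<in> B" for \<beta>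
    using pre[OF that] by (auto simp: fps_eq_iff fps_X_power_mult_nth coeff_R)
  have val: "poly g (fps_shift N \<beta>) = fps_X ^ K * a \<beta>" if "\<beta> \<in> B" for \<beta>
    using reg[OF that] split[OF that] by (simp add: g K_def)
  have inf': "infinite ((\<lambda>h. fps_nth h 0) ` (fps_shift N ` B))"
    using inf by (simp add: image_image)
  have zero: "fps_nth (poly g h) k = 0" if "h \<in> fps_shift N ` B" "k < K" for h k
    using that val by (auto simp: fps_X_power_mult_nth)
  note trunc = fps_poly_truncate[OF inf' zero]
  define x where "x = fps_nth \<beta> N"
  \<comment> \<open>The value of \<open>g\<close> at the constant \<open>x\<close>, now as a genuine
    polynomial in \<open>s\<close>, so that it has limits at 0.\<close>
  define T where "T = homog (\<lambda>a. [:a:]) p D (monom 1 m) (R + monom 1 N * [:x:])"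
  have T: "fps_of_poly T = poly g (fps_const x)"
    unfolding T_def g
    by (subst homog_map[of fps_of_poly])
       (simp_all add: fps_of_poly_add fps_of_poly_mult fps_of_poly_monom' fps_of_poly_const
             del: mult_pCons_right)
  have T_coeff: "coeff T k = fps_nth (poly g (fps_const x)) k" for k
    by (simp flip: T)
  have "((\<lambda>s. poly T s / s ^ K) \<longlongrightarrow> coeff T K) (at 0)"
    by (rule poly_divide_power_tendsto) (simp add: T_coeff trunc(1))
  also have "coeff T K = fps_nth (a \<beta>) 0"
    using trunc(2)[where h = "fps_shift N \<beta>"] val[OF \<beta>]
    by (simp add: T_coeff x_def fps_X_power_mult_nth)
  finally have lim: "((\<lambda>s. poly T s / s ^ K) \<longlongrightarrow> fps_nth (a \<beta>) 0) (at 0)" .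
  have "poly T s / s ^ K = eval2 p (truncated_curve m N \<beta> s)" if "s \<noteq> 0" for s
  proof -
    have "poly R s + s ^ N * x = (\<Sum>i\<le>N. fps_nth \<beta> i * s ^ i)"
    proof -
      have "{..N} = insert N {..<N}" by auto
      then show ?thesis using pre[OF \<beta>]
        by (simp add: R_def poly_sum poly_monom x_def)
    qed
    then have "poly T s = homog (\<lambda>a. a) p D (s ^ m) (\<Sum>i\<le>N. fps_nth \<beta> i * s ^ i)"
      unfolding T_def by (subst homog_map[of "\<lambda>q. poly q s"]) (simp_all add: poly_monom del: mult_pCons_right)
    also have "\<dots> = eval2 p (truncated_curve m N \<beta> s) * s ^ K"
    proof -
      have "(s ^ m) ^ (2 * D) = s ^ K" by (simp add: K_def mult.commute flip: power_mult)
      then show ?thesis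
        using that eval2_affine_point[OF deg, of "s ^ m"] by (simp add: truncated_curve_def)
    qed
    finally show ?thesis using that by simp
  qed
  then have "eventually (\<lambda>s. poly T s / s ^ K = eval2 p (truncated_curve m N \<beta> s)) (at 0)"
    by (simp add: eventually_at_filter)
  with lim show ?thesis by (rule Lim_transform_eventually)
qed

text \<open>
  Substituting the inverse of \<open>s\<^sub>e(t)\<close> into the polynomial identity
  \<open>A Z\<^sup>2\<^sup>D = A\<^sub>0 Z\<^sup>2\<^sup>D p(1/Z, Q/Z)\<close> on the line of constant \<open>e\<close>.
\<close>

lemma homog_expansion:
  assumes deg: "bidegree_le p D" and m: "m \<ge> 1" and ex: "expansion bs m e \<beta>"
    and nz: "specialize2 (Z_poly bs) e \<noteq> 0" and A0: "eval2 A0 (0, e) \<noteq> 0"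
    and rep: "\<And>t. eval2 (Z_poly bs) (t, e) \<noteq> 0 \<Longrightarrow> eval2 A (t, e) = eval2 A0 (t, e) *
      eval2 p (affine_point 1 (eval2 (Q_poly bs) (t, e)) (eval2 (Z_poly bs) (t, e)))"
  shows "\<exists>a. homog fps_const p D (fps_X ^ m) \<beta> = fps_X ^ (2 * D * m) * a \<and>
             fps_nth a 0 = eval2 A (0, e) / eval2 A0 (0, e)"
proof -
  let ?Z = "specialize2 (Z_poly bs) e" and ?Q = "specialize2 (Q_poly bs) e"
  let ?A = "specialize2 A e" and ?C = "specialize2 A0 e"
  obtain s where s: "fps_nth s 0 = 0" "fps_nth s 1 \<noteq> 0" "s ^ m = fps_of_poly ?Z"
      "fps_compose \<beta> s = fps_of_poly ?Q"
    using ex by (auto simp: expansion_def local_param_def)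
  define \<tau> where "\<tau> = fps_inv s"
  have \<tau>: "fps_nth \<tau> 0 = 0" "fps_compose s \<tau> = fps_X"
    using fps_inv_right[OF s(1,2)] by (simp_all add: \<tau>_def fps_inv_def)
  \<comment> \<open>Both sides are polynomials in \<open>t\<close>, so agreement off the zeros of
    \<open>Z_e\<close> suffices.\<close>
  have "?A * ?Z ^ (2 * D) = ?C * homog (\<lambda>a. [:a:]) p D ?Z ?Q"
  proof (rule poly_eqI_infinite)
    show "infinite {t. poly ?Z t \<noteq> 0}"
      using infinite_MOST_conj[OF infinite_UNIV_char_0 MOST_poly_nonzero[OF nz]] by simp
    fix t assume "t \<in> {t. poly ?Z t \<noteq> 0}"
    then have t: "poly ?Z t \<noteq> 0" by simp
    have ev: "eval2 r (t, e) = poly (specialize2 r e) t" for r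
      by (simp add: eval2_def)
    have "poly ?A t = poly ?C t * eval2 p (affine_point 1 (poly ?Q t) (poly ?Z t))"
      using rep[of t] t unfolding ev by blast
    then have "poly (?A * ?Z ^ (2 * D)) t =
        poly ?C t * (eval2 p (affine_point 1 (poly ?Q t) (poly ?Z t)) * poly ?Z t ^ (2 * D))"
      by simp
    also have "\<dots> = poly ?C t * homog (\<lambda>a. a) p D (poly ?Z t) (poly ?Q t)"
      by (simp only: eval2_affine_point[OF deg t])
    also have "homog (\<lambda>a. a) p D (poly ?Z t) (poly ?Q t) = poly (homog (\<lambda>a. [:a:]) p D ?Z ?Q) t"
      by (subst homog_map[of "\<lambda>q. poly q t"]) simp_all
    finally show "poly (?A * ?Z ^ (2 * D)) t = poly (?C * homog (\<lambda>a. [:a:]) p D ?Z ?Q) t" by simp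
  qed
  then have "fps_of_poly ?A * s ^ (m * (2 * D)) =
      fps_of_poly ?C * fps_of_poly (homog (\<lambda>a. [:a:]) p D ?Z ?Q)"
    unfolding power_mult s(3) by (simp flip: fps_of_poly_mult fps_of_poly_power)
  also have "fps_of_poly (homog (\<lambda>a. [:a:]) p D ?Z ?Q) = homog fps_const p D (s ^ m) (fps_compose \<beta> s)"
    by (subst homog_map[of fps_of_poly])
       (simp_all add: fps_of_poly_add fps_of_poly_mult fps_of_poly_const s)
  finally have eq: "fps_of_poly ?A * s ^ (m * (2 * D)) =
      fps_of_poly ?C * homog fps_const p D (s ^ m) (fps_compose \<beta> s)" .
  \<comment> \<open>Composition with \<tau>, the inverse of \<open>s\<close>, makes the parameter
    the new variable.\<close>
  have "fps_compose (fps_compose \<beta> s) \<tau> = \<beta>"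
    using fps_compose_assoc[OF \<tau>(1) s(1), of \<beta>] \<tau>(2) by simp
  then have hom: "fps_compose (homog fps_const p D (s ^ m) (fps_compose \<beta> s)) \<tau> =
      homog fps_const p D (fps_X ^ m) \<beta>"
    by (subst homog_map[of "\<lambda>F. fps_compose F \<tau>"])
       (simp_all add: fps_compose_add_distrib fps_compose_mult_distrib[OF \<tau>(1)] \<tau>(2)
          flip: fps_compose_power[OF \<tau>(1)])
  let ?B = "fps_compose (fps_of_poly ?A) \<tau>" and ?E = "fps_compose (fps_of_poly ?C) \<tau>"
  have "?B * fps_X ^ (m * (2 * D)) = ?E * homog fps_const p D (fps_X ^ m) \<beta>"
    using arg_cong[OF eq, of "\<lambda>F. fps_compose F \<tau>"]
    by (simp add: fps_compose_mult_distrib[OF \<tau>(1)] hom \<tau>(2) flip: fps_compose_power[OF \<tau>(1)])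
  moreover have B0: "fps_nth ?E 0 = eval2 A0 (0, e)" "fps_nth ?B 0 = eval2 A (0, e)"
    by (simp_all add: eval2_def poly_0_coeff_0)
  then have "inverse ?E * ?E = 1" using A0 by (intro inverse_mult_eq_1) simp
  ultimately have "homog fps_const p D (fps_X ^ m) \<beta> = fps_X ^ (2 * D * m) * (?B * inverse ?E)"
    by (metis (no_types, lifting) mult.assoc mult.commute mult_1)
  then show ?thesis using B0
    by (intro exI[of _ "?B * inverse ?E"]) (simp add: field_simps)
qed

section \<open>Generic points of \<Gamma> and assembly of the limit\<close>

lemma maps_to_in_dominated:
  assumes "dominates f bs V" "maps_to f bs e y"
  shows "y \<in> V"
proof -
  have "topspace zariski = UNIV"
  proof -
    have "{z. eval2 1 z \<noteq> 0} = UNIV" by (auto simp: eval2_def specialize2_def)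
    then show ?thesis unfolding zariski_def topology_generated_by_topspace by blast
  qed
  then have "{y. \<exists>e. maps_to f bs e y} \<subseteq> zariski closure_of {y. \<exists>e. maps_to f bs e y}"
    by (intro closure_of_subset) simp
  then show ?thesis using assms by (auto simp: dominates_def)
qed

text \<open>As \<open>V\<close> is nonempty, some point of \<Gamma> is mapped into the affine plane.
  The representation used there serves almost all \<open>e\<close>, because \<open>A0\<close>
  restricted to \<Gamma> is a nonzero polynomial in \<open>e\<close>.\<close>

lemma generic_representation:
  assumes "dominates f bs V" "V \<noteq> {}"
  shows "\<exists>A1 A2 A0. represents f bs A1 A2 A0 \<and> (MOST e. eval2 A0 (0, e) \<noteq> 0)"
proof -
  have "{y. \<exists>e. maps_to f bs e y} \<noteq> {}"
    using assms unfolding dominates_def by (metis closure_of_empty)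
  then obtain A1 A2 A0 e where A: "represents f bs A1 A2 A0" "eval2 A0 (0, e) \<noteq> 0"
    by (auto simp: maps_to_def)
  have *: "eval2 A0 (0, e) = poly (coeff A0 0) e" for e
    by (simp add: eval2_def poly_0_coeff_0 coeff_specialize2)
  with A(2) have "coeff A0 0 \<noteq> 0" by auto
  from MOST_poly_nonzero[OF this] have "MOST e. eval2 A0 (0, e) \<noteq> 0" by (simp only: *)
  with A(1) show ?thesis by blast
qed

text \<open>Constancy concerns one suitable choice of parameter for each \<open>i\<close>; any other
  choice changes the coefficient only within the \<open>m\<close>-th roots of
  \<open>c i ^ m\<close>, which leaves finitely many prefixes.\<close>

lemma finite_expansion_prefixes:
  assumes m: "m \<ge> 1" and gen: "generic_order bs m" and const: "\<forall>i<N. coeff_constant bs m i"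
  shows "\<exists>S. finite S \<and> (MOST e. \<forall>\<beta>. expansion bs m e \<beta> \<longrightarrow> fps_cutoff N \<beta> \<in> S)"
proof -
  have "\<forall>i\<in>{..<N}. \<exists>c. MOST e. \<exists>\<beta>. expansion bs m e \<beta> \<and> fps_nth \<beta> i = c"
    using const by (simp add: coeff_constant_def)
  from bchoice[OF this] obtain c where
    c: "\<forall>i\<in>{..<N}. MOST e. \<exists>\<beta>. expansion bs m e \<beta> \<and> fps_nth \<beta> i = c i" by blast
  define T where "T = PiE {..<N} (\<lambda>i. {z. z ^ m = c i ^ m})"
  define S where "S = (\<lambda>g. Abs_fps (\<lambda>i. if i < N then g i else 0)) ` T"
  have "finite T" unfolding T_def using m by (intro finite_PiE finite_nth_roots) auto
  then have "finite S" by (simp add: S_def)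
  moreover have "MOST e. \<forall>i<N. \<exists>\<beta>. expansion bs m e \<beta> \<and> fps_nth \<beta> i = c i"
    using eventually_ball_finite[OF finite_lessThan c] by (simp only: Ball_def lessThan_iff)
  then have "MOST e. \<forall>\<beta>. expansion bs m e \<beta> \<longrightarrow> fps_cutoff N \<beta> \<in> S"
    using gen[unfolded generic_order_def]
  proof eventually_elim
    case (elim e)
    show ?case
    proof (intro allI impI)
      fix \<beta> assume \<beta>: "expansion bs m e \<beta>"
      have "poly (lead_poly bs m) e \<noteq> 0"
        using coeff_order_0(1)[of "specialize2 (Z_poly bs) e"] elim(2)
        by (simp add: lead_poly_def coeff_specialize2)
      then have "fps_nth \<beta> i ^ m = c i ^ m" if "i < N" for i
        using elim(1) that expansion_nth_power[OF m, of bs e _ i] elim(2) \<beta>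
        by (metis mult_right_cancel power_not_zero)
      then have "restrict (fps_nth \<beta>) {..<N} \<in> T" by (simp add: T_def)
      moreover have "fps_cutoff N \<beta> =
          Abs_fps (\<lambda>i. if i < N then restrict (fps_nth \<beta>) {..<N} i else 0)"
        by (simp add: fps_eq_iff)
      ultimately show "fps_cutoff N \<beta> \<in> S" unfolding S_def by blast
    qed
  qed
  ultimately show ?thesis by blast
qed

text \<open>Otherwise one value of the \<open>N\<close>-th coefficient would recur at infinitely
  many \<open>e\<close>, and \<open>coeff_constant_if_power_constant\<close> would make the
  coefficient constant.\<close>

lemma infinite_nonconstant_coeff:
  assumes m: "m \<ge> 1" and gen: "generic_order bs m" and N: "\<not> coeff_constant bs m N"
    and inf: "infinite E"
    and E: "\<And>e. e \<in> E \<Longrightarrow> specialize2 (Z_poly bs) e \<noteq> 0 \<and>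
      order 0 (specialize2 (Z_poly bs) e) = m \<and> (\<exists>\<beta>\<in>B. expansion bs m e \<beta>)"
  shows "infinite ((\<lambda>\<beta>. fps_nth \<beta> N) ` B)"
proof
  assume fin: "finite ((\<lambda>\<beta>. fps_nth \<beta> N) ` B)"
  obtain \<beta> where \<beta>: "\<And>e. e \<in> E \<Longrightarrow> \<beta> e \<in> B \<and> expansion bs m e (\<beta> e)"
    using E by metis
  have "finite ((\<lambda>e. fps_nth (\<beta> e) N) ` E)"
    by (rule finite_subset[OF _ fin]) (use \<beta> in auto)
  from pigeonhole_infinite[OF inf this] obtain e0 where
    "infinite {e \<in> E. fps_nth (\<beta> e) N = fps_nth (\<beta> e0) N}" by blast
  moreover have "{e \<in> E. fps_nth (\<beta> e) N = fps_nth (\<beta> e0) N} \<subseteq>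
      {e. fps_nth (unit_expansion bs m e) N ^ m = fps_nth (\<beta> e0) N ^ m * poly (lead_poly bs m) e ^ N}"
  proof
    fix e assume e: "e \<in> {e \<in> E. fps_nth (\<beta> e) N = fps_nth (\<beta> e0) N}"
    then show "e \<in> {e. fps_nth (unit_expansion bs m e) N ^ m =
        fps_nth (\<beta> e0) N ^ m * poly (lead_poly bs m) e ^ N}"
      using expansion_nth_power[OF m, of bs e "\<beta> e" N] E[of e] \<beta>[of e] by simp
  qed
  ultimately have "infinite {e. fps_nth (unit_expansion bs m e) N ^ m =
      fps_nth (\<beta> e0) N ^ m * poly (lead_poly bs m) e ^ N}"
    using infinite_super by blast
  then show False using coeff_constant_if_power_constant[OF m gen] N by blast
qed

text \<open>Here \<open>p\<close> stands for either component of \<open>f\<close>, and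
  \<open>A\<close> for the matching numerator on the last chart.\<close>

lemma component_tendsto:
  assumes m: "m \<ge> 1"
    and rep: "\<And>z. eval2 (Z_poly bs) z \<noteq> 0 \<Longrightarrow> eval2 A z = eval2 A0 z *
      eval2 p (affine_point 1 (eval2 (Q_poly bs) z) (eval2 (Z_poly bs) z))"
    and pre: "\<And>\<beta>. \<beta> \<in> B \<Longrightarrow> fps_cutoff N \<beta> = c"
    and inf: "infinite ((\<lambda>\<beta>. fps_nth \<beta> N) ` B)"
    and B: "\<And>\<beta>. \<beta> \<in> B \<Longrightarrow> \<exists>e. expansion bs m e \<beta> \<and> specialize2 (Z_poly bs) e \<noteq> 0 \<and> eval2 A0 (0, e) \<noteq> 0"
    and \<beta>: "\<beta> \<in> B" "expansion bs m e \<beta>" "specialize2 (Z_poly bs) e \<noteq> 0" "eval2 A0 (0, e) \<noteq> 0"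
  shows "((\<lambda>s. eval2 p (truncated_curve m N \<beta> s)) \<longlongrightarrow> eval2 A (0, e) / eval2 A0 (0, e)) (at 0)"
proof -
  obtain D where D: "bidegree_le p D" using ex_bidegree_le by blast
  have "\<exists>a. homog fps_const p D (fps_X ^ m) \<beta> = fps_X ^ (2 * D * m) * a" if "\<beta> \<in> B" for \<beta>
    using B[OF that] homog_expansion[OF D m _ _ _ rep] by blast
  then obtain a where a: "\<And>\<beta>. \<beta> \<in> B \<Longrightarrow>
      homog fps_const p D (fps_X ^ m) \<beta> = fps_X ^ (2 * D * m) * a \<beta>" by metis
  have "((\<lambda>s. eval2 p (truncated_curve m N \<beta> s)) \<longlongrightarrow> fps_nth (a \<beta>) 0) (at 0)"
  proof (rule truncated_curve_tendsto[OF D m _ inf a \<beta>(1)])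
    fix \<beta> i assume "\<beta> \<in> B" "i < N"
    then show "fps_nth \<beta> i = fps_nth c i" using pre by (metis fps_cutoff_nth)
  qed
  moreover have "fps_nth (a \<beta>) 0 = eval2 A (0, e) / eval2 A0 (0, e)"
    using homog_expansion[OF D m \<beta>(2-4) rep] a[OF \<beta>(1)] by auto
  ultimately show ?thesis by simp
qed

theorem theorem8:
  fixes f :: "bipoly \<times> bipoly"
    and V :: "(complex \<times> complex) set"
    and bs :: "blowup_step list"
    and m N :: nat
  assumes "keller f"
    and "irreducible_component V (nonproper_set (poly_map2 f))"
    and "codim_one V"
    and "blowup_sequence bs"
    and "dominates f bs V"
    and "m \<ge> 1"
    and "generic_order bs m"
    and "first_nonconstant bs m N"
  shows "MOST e. \<exists>y\<in>V. maps_to f bs e y \<and>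
           (\<forall>\<beta>. expansion bs m e \<beta> \<longrightarrow>
              ((\<lambda>s. poly_map2 f (truncated_curve m N \<beta> s)) \<longlongrightarrow> y) (at 0))"
proof -
  note m = \<open>m \<ge> 1\<close> and gen = \<open>generic_order bs m\<close>
  have N: "\<not> coeff_constant bs m N" "\<forall>i<N. coeff_constant bs m i"
    using \<open>first_nonconstant bs m N\<close> by (simp_all add: first_nonconstant_def)
  have "V \<noteq> {}"
    using assms(2) by (auto simp: irreducible_component_def irreducible_set_def)
  then obtain A1 A2 A0 where rep: "represents f bs A1 A2 A0" and A0: "MOST e. eval2 A0 (0, e) \<noteq> 0"
    using generic_representation[OF assms(5)] by blast
  have rep1: "eval2 A1 z = eval2 A0 z *
      eval2 (fst f) (affine_point 1 (eval2 (Q_poly bs) z) (eval2 (Z_poly bs) z))"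
    and rep2: "eval2 A2 z = eval2 A0 z *
      eval2 (snd f) (affine_point 1 (eval2 (Q_poly bs) z) (eval2 (Z_poly bs) z))"
    if "eval2 (Z_poly bs) z \<noteq> 0" for z
    using rep that by (cases z; simp add: represents_def poly_map2_def Let_def)+
  obtain S where S: "finite S" "MOST e. \<forall>\<beta>. expansion bs m e \<beta> \<longrightarrow> fps_cutoff N \<beta> \<in> S"
    using finite_expansion_prefixes[OF m gen N(2)] by blast
  define y where "y e = affine_point (eval2 A1 (0, e)) (eval2 A2 (0, e)) (eval2 A0 (0, e))" for e
  define good where "good e \<longleftrightarrow> specialize2 (Z_poly bs) e \<noteq> 0 \<and>
    order 0 (specialize2 (Z_poly bs) e) = m \<and> eval2 A0 (0, e) \<noteq> 0" for e
  have good: "MOST e. good e"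
    using gen[unfolded generic_order_def] A0 by eventually_elim (simp add: good_def)
  \<comment> \<open>The finite exceptional set may depend on the prefix \<open>c\<close>; finiteness
    of \<open>S\<close> later allows the union to be taken.\<close>
  have "MOST e. \<forall>\<beta>. expansion bs m e \<beta> \<and> fps_cutoff N \<beta> = c \<longrightarrow>
      ((\<lambda>s. poly_map2 f (truncated_curve m N \<beta> s)) \<longlongrightarrow> y e) (at 0)" for c
  proof -
    define E where "E = {e. good e \<and> (\<exists>\<beta>. expansion bs m e \<beta> \<and> fps_cutoff N \<beta> = c)}"
    show ?thesis
    proof (cases "finite E")
      case True
      \<comment> \<open>A prefix occurring at only finitely many good \<open>e\<close> is disposed
        of by excluding those \<open>e\<close>.\<close>
      then have "MOST e. e \<notin> E" by (simp add: MOST_iff_cofinite)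
      with good show ?thesis by eventually_elim (auto simp: E_def)
    next
      case False
      \<comment> \<open>All good \<open>e\<close> contribute, since the infinitely many
        \<open>N\<close>-th coefficients come from varying \<open>e\<close>.\<close>
      define B where "B = {\<beta>. fps_cutoff N \<beta> = c \<and> (\<exists>e. good e \<and> expansion bs m e \<beta>)}"
      have inf: "infinite ((\<lambda>\<beta>. fps_nth \<beta> N) ` B)"
        by (rule infinite_nonconstant_coeff[OF m gen N(1) False])
           (auto simp: E_def B_def good_def)
      have pre: "\<And>\<beta>. \<beta> \<in> B \<Longrightarrow> fps_cutoff N \<beta> = c"
        and B: "\<And>\<beta>. \<beta> \<in> B \<Longrightarrow>
          \<exists>e. expansion bs m e \<beta> \<and> specialize2 (Z_poly bs) e \<noteq> 0 \<and> eval2 A0 (0, e) \<noteq> 0"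
        by (auto simp: B_def good_def)
      from good show ?thesis
      proof eventually_elim
        case (elim e)
        show ?case
        proof (intro allI impI)
          fix \<beta> assume \<beta>: "expansion bs m e \<beta> \<and> fps_cutoff N \<beta> = c"
          then have \<beta>B: "\<beta> \<in> B" using elim by (auto simp: B_def)
          from elim \<beta> have e: "expansion bs m e \<beta>" "specialize2 (Z_poly bs) e \<noteq> 0" "eval2 A0 (0, e) \<noteq> 0"
            by (simp_all add: good_def)
          show "((\<lambda>s. poly_map2 f (truncated_curve m N \<beta> s)) \<longlongrightarrow> y e) (at 0)"
            unfolding poly_map2_def y_def affine_point_def
            by (intro tendsto_Pair component_tendsto[OF m rep1 pre inf B \<beta>B e]
                  component_tendsto[OF m rep2 pre inf B \<beta>B e])
        qed
      qed
    qed
  qed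
  then have "\<forall>c\<in>S. MOST e. \<forall>\<beta>. expansion bs m e \<beta> \<and> fps_cutoff N \<beta> = c \<longrightarrow>
      ((\<lambda>s. poly_map2 f (truncated_curve m N \<beta> s)) \<longlongrightarrow> y e) (at 0)" by blast
  from eventually_ball_finite[OF S(1) this] have "MOST e. \<forall>c\<in>S. \<forall>\<beta>. expansion bs m e \<beta> \<and> fps_cutoff N \<beta> = c \<longrightarrow>
      ((\<lambda>s. poly_map2 f (truncated_curve m N \<beta> s)) \<longlongrightarrow> y e) (at 0)"
    .
  with S(2) A0 show ?thesis
  proof eventually_elim
    case (elim e)
    have "maps_to f bs e (y e)"
      using rep elim(2) unfolding maps_to_def y_def by blast
    then show ?case
      using maps_to_in_dominated[OF assms(5)] elim(1,3) by blast
  qed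
qed

end
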